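(* Let $I\subset\mathbb{R}$ be an interval and let $(\alpha,\ell,m,n):I\to\mathbb{R}^4$ be a smooth mapping. Then there exists a pseudo-spherical spacelike framed curve $(\gamma_s,v_1,v_2):I\to AdS^3\times\Delta_1$ whose curvature is $(\alpha,\ell,m,n)$.
   Context: $\mathbb{R}^4_2$ is $\mathbb{R}^4$ with $\langle u,w\rangle=-u_1w_1-u_2w_2+u_3w_3+u_4w_4$; the triple product $u\times v\times w$ is the unique vector with $\langle x,u\times v\times w\rangle=\det(x,u,v,w)$ for all $x$. $AdS^3=\{u:\langle u,u\rangle=-1\}$, $S^3_2=\{u:\langle u,u\rangle=1\}$, and $\Delta_1=\{(u,w):\langle u,w\rangle=0\}\subset AdS^3\times S^3_2$ (or $\subset S^3_2\times AdS^3$). A pseudo-spherical spacelike framed curve is a smooth map $(\gamma_s,v_1,v_2):I\to AdS^3\times\Delta_1$ with $\langle\gamma_s,v_i\rangle=0$ and $\langle\gamma_s',v_i\rangle=0$ on $I$ for $i=1,2$ (so $\gamma_s\in AdS^3$, and one of $v_1,v_2$ is in $S^3_2$, the other in $AdS^3$). Put $\mu=\gamma_s\times v_1\times v_2$ and $\epsilon=\langle v_1,v_1\rangle\in\{\pm1\}$. The curvature of $(\gamma_s,v_1,v_2)$ is $(\alpha,\ell,m,n)$ with $\alpha=\langle\gamma_s',\mu\rangle$, $\ell=-\epsilon\langle v_1',v_2\rangle$, $m=\langle v_1',\mu\rangle$, $n=\langle v_2',\mu\rangle$; equivalently $\gamma_s'=\alpha\mu$, $v_1'=\ell v_2+m\mu$,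 $v_2'=\ell v_1+n\mu$, $\mu'=\alpha\gamma_s-\epsilon m v_1+\epsilon n v_2$. *)

theory Defs
  imports "HOL-Analysis.Analysis"
begin

definition ip :: "real ^ 4 \<Rightarrow> real ^ 4 \<Rightarrow> real"
  where "ip u w = - u $ 1 * w $ 1 - u $ 2 * w $ 2 + u $ 3 * w $ 3 + u $ 4 * w $ 4"

definition triple :: "real ^ 4 \<Rightarrow> real ^ 4 \<Rightarrow> real ^ 4 \<Rightarrow> real ^ 4"
  where "triple u v w = (THE c. \<forall>x. ip x c = det (vector [x, u, v, w] :: real ^ 4 ^ 4))"

lemma vector_4 [simp]:
  "(vector [x, y, z, w] :: 'a::zero ^ 4) $ 1 = x"
  "(vector [x, y, z, w] :: 'a::zero ^ 4) $ 2 = y"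
  "(vector [x, y, z, w] :: 'a::zero ^ 4) $ 3 = z"
  "(vector [x, y, z, w] :: 'a::zero ^ 4) $ 4 = w"
  unfolding vector_def by simp_all

lemma ip_triple: "ip x (triple u v w) = det (vector [x, u, v, w] :: real ^ 4 ^ 4)"
proof -
  let ?D = "\<lambda>x. det (vector [x, u, v, w] :: real ^ 4 ^ 4)"
  define r where "r i = (vector [0, u, v, w] :: real ^ 4 ^ 4) $ i" for i
  have row: "(vector [x, u, v, w] :: real ^ 4 ^ 4) = (\<chi> i. if i = 1 then x else r i)" for x
    by (simp add: vec_eq_iff forall_4 r_def)
  have "linear ?D"
  proof (rule linearI)
    show "?D (x + y) = ?D x + ?D y" for x y
      unfolding row using det_row_add[of 1 "\<lambda>_. x" "\<lambda>_. y" r] by simp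
    show "?D (c *\<^sub>R x) = c *\<^sub>R ?D x" for c x
      unfolding row scalar_mult_eq_scaleR[symmetric]
      using det_row_mul[of 1 c "\<lambda>_. x" r] by simp
  qed
  then have "\<exists>d. \<forall>x. ?D x = x \<bullet> d"
    by (intro exI[of _ "adjoint ?D 1"]) (simp add: adjoint_works)
  then obtain d where d: "\<And>x. ?D x = x \<bullet> d"
    by blast
  have "\<exists>!c. \<forall>x. ip x c = ?D x"
  proof (rule ex1I)
    show "\<forall>x. ip x (vector [- d $ 1, - d $ 2, d $ 3, d $ 4]) = ?D x"
      by (simp add: d ip_def inner_vec_def sum_4)
    fix c assume c: "\<forall>x. ip x c = ?D x"
    have "ip (axis i 1) c = d $ i" for i
      using c by (simp add: d inner_axis')
    from this[of 1] this[of 2] this[of 3] this[of 4]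
    show "c = vector [- d $ 1, - d $ 2, d $ 3, d $ 4]"
      by (auto simp: vec_eq_iff forall_4 ip_def axis_def)
  qed
  from theI'[OF this] show ?thesis
    unfolding triple_def by blast
qed

definition AdS3 :: "(real ^ 4) set"
  where "AdS3 = {u. ip u u = -1}"

definition S32 :: "(real ^ 4) set"
  where "S32 = {u. ip u u = 1}"

text \<open>The symbol \<open>\<Delta>\<^sub>1\<close> denotes either of the two following sets.\<close>

definition Delta1_AdS_S :: "((real ^ 4) \<times> (real ^ 4)) set"
  where "Delta1_AdS_S = {(u, w) \<in> AdS3 \<times> S32. ip u w = 0}"

definition Delta1_S_AdS :: "((real ^ 4) \<times> (real ^ 4)) set"
  where "Delta1_S_AdS = {(u, w) \<in> S32 \<times> AdS3. ip u w = 0}"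

text \<open>\<open>D k\<close> is the \<open>k\<close>-th derivative of \<open>f\<close> on \<open>I\<close>; it is one-sided at an end point of an
  interval \<open>I\<close> that belongs to \<open>I\<close>.\<close>

definition smooth_map_on :: "real set \<Rightarrow> (real \<Rightarrow> 'a::real_normed_vector) \<Rightarrow> bool"
  where "smooth_map_on I f \<longleftrightarrow>
    (\<exists>D :: nat \<Rightarrow> real \<Rightarrow> 'a. D 0 = f \<and>
      (\<forall>k. \<forall>t\<in>I. (D k has_vector_derivative D (Suc k) t) (at t within I)))"

text \<open>The derivative inside \<open>I\<close>, unique when \<open>I\<close> is a nondegenerate interval.\<close>

abbreviation deriv_on :: "real set \<Rightarrow> (real \<Rightarrow> 'a::real_normed_vector) \<Rightarrow> real \<Rightarrow> 'a"
  where "deriv_on I f t \<equiv> vector_derivative f (at t within I)"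

definition ps_spacelike_framed_curve ::
  "((real ^ 4) \<times> (real ^ 4)) set \<Rightarrow> real set \<Rightarrow>
    (real \<Rightarrow> real ^ 4) \<Rightarrow> (real \<Rightarrow> real ^ 4) \<Rightarrow> (real \<Rightarrow> real ^ 4) \<Rightarrow> bool"
  where "ps_spacelike_framed_curve \<Delta> I \<gamma> v1 v2 \<longleftrightarrow>
    smooth_map_on I (\<lambda>t. (\<gamma> t, v1 t, v2 t)) \<and>
    (\<forall>t\<in>I. (\<gamma> t, v1 t, v2 t) \<in> AdS3 \<times> \<Delta> \<and>
      ip (\<gamma> t) (v1 t) = 0 \<and> ip (\<gamma> t) (v2 t) = 0 \<and>
      ip (deriv_on I \<gamma> t) (v1 t) = 0 \<and> ip (deriv_on I \<gamma> t) (v2 t) = 0)"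

definition curvature ::
  "real set \<Rightarrow> (real \<Rightarrow> real ^ 4) \<Rightarrow> (real \<Rightarrow> real ^ 4) \<Rightarrow> (real \<Rightarrow> real ^ 4) \<Rightarrow> real \<Rightarrow>
    real \<times> real \<times> real \<times> real"
  where "curvature I \<gamma> v1 v2 t =
    (let \<mu> = triple (\<gamma> t) (v1 t) (v2 t); \<epsilon> = ip (v1 t) (v1 t) in
      (ip (deriv_on I \<gamma> t) \<mu>,
       - \<epsilon> * ip (deriv_on I v1 t) (v2 t),
       ip (deriv_on I v1 t) \<mu>,
       ip (deriv_on I v2 t) \<mu>))"

end

theory Submission
  imports Defs
begin

text \<open>The structure equations form a linear system \<open>F' = A F\<close> for the matrix \<open>F\<close> with rows
  \<open>\<mu>\<close>, \<open>\<gamma>\<close>, \<open>v1\<close>, \<open>v2\<close>; it has a solution on all of \<open>I\<close>. With \<open>G = diag(1, -1, \<epsilon>, -\<epsilon>)\<close> one has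
  \<open>G A + A\<^sup>T G = 0\<close>, so \<open>F\<^sup>T G F\<close> is constant, and no uniqueness theorem is needed to see that a frame
  that is pseudo-orthonormal at one point stays so. Then \<open>det F = \<plusminus>1\<close> is constant as well,
  whence \<open>\<mu> = \<gamma> \<times> v1 \<times> v2\<close> persists. Finally all entries of \<open>F\<close> and all derivatives of the curvature
  generate an algebra of functions closed under differentiation, which makes them smooth.\<close>

section \<open>Calculus on arbitrary intervals\<close>

text \<open>Reduces work on an interval that may be open, half-open or unbounded to a compact one.
  The filter at \<open>t\<close> is preserved because \<open>t\<close> becomes an end point of
  \<open>{a..b}\<close> only where it is already an end point of \<open>I\<close>.\<close>

lemma interval_at_within_Icc:
  fixes I :: "real set"
  assumes "is_interval I" "s \<in> I" "t \<in> I"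
  obtains a b where "{a..b} \<subseteq> I" "s \<in> {a..b}" "t \<in> {a..b}" "at t within {a..b} = at t within I"
proof -
  have conv: "\<And>x y z. x \<in> I \<Longrightarrow> y \<in> I \<Longrightarrow> x \<le> z \<Longrightarrow> z \<le> y \<Longrightarrow> z \<in> I"
    using assms(1) unfolding is_interval_1 by blast
  have "\<exists>b\<in>I. s \<le> b \<and> t \<le> b \<and> ((\<exists>x\<in>I. t < x) \<longrightarrow> t < b)"
  proof (cases "\<exists>x\<in>I. t < x")
    case True
    then obtain x where "x \<in> I" "t < x" by blast
    then show ?thesis
      using assms by (intro bexI[of _ "max s x"]) (auto simp: max_def)
  next
    case False
    then show ?thesis
      using assms by (intro bexI[of _ t]) force+
  qed
  then obtain b where b: "b \<in> I" "s \<le> b" "t \<le> b" "(\<exists>x\<in>I. t < x) \<longrightarrow> t < b" by blast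
  have "\<exists>a\<in>I. a \<le> s \<and> a \<le> t \<and> ((\<exists>x\<in>I. x < t) \<longrightarrow> a < t)"
  proof (cases "\<exists>x\<in>I. x < t")
    case True
    then obtain x where "x \<in> I" "x < t" by blast
    then show ?thesis
      using assms by (intro bexI[of _ "min s x"]) (auto simp: min_def)
  next
    case False
    then show ?thesis
      using assms by (intro bexI[of _ t]) force+
  qed
  then obtain a where a: "a \<in> I" "a \<le> s" "a \<le> t" "(\<exists>x\<in>I. x < t) \<longrightarrow> a < t" by blast
  have sub: "{a..b} \<subseteq> I"
    using conv[OF a(1) b(1)] by auto
  \<comment> \<open>\<open>U\<close> cuts off only at those end points of \<open>{a..b}\<close> that
    differ from \<open>t\<close>; on a side where the end point equals \<open>t\<close>,
    \<open>I\<close> itself has no further points.\<close>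
  define U where "U = (if t < b then {..<b} else UNIV) \<inter> (if a < t then {a<..} else UNIV)"
  have "at t within {a..b} = at t within I"
  proof (rule at_within_nhd)
    show "t \<in> U" "open U"
      by (auto simp: U_def)
    show "{a..b} \<inter> U - {t} = I \<inter> U - {t}"
      using sub a b by (force simp: U_def not_less)
  qed
  then show ?thesis
    using that[of a b] sub a b by simp
qed

lemma interval_antiderivative:
  fixes g :: "real \<Rightarrow> 'a::banach"
  assumes "is_interval I" "s \<in> I" "continuous_on I g"
  obtains G where "G s = 0" "\<And>t. t \<in> I \<Longrightarrow> (G has_vector_derivative g t) (at t within I)"
proof -
  define G where "G t = (if s \<le> t then integral {s..t} g else - integral {t..s} g)" for t
  have "(G has_vector_derivative g t) (at t within I)" if t: "t \<in> I" for t
  proof -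
    obtain a b where ab: "{a..b} \<subseteq> I" "s \<in> {a..b}" "t \<in> {a..b}" "at t within {a..b} = at t within I"
      using interval_at_within_Icc[OF assms(1,2) t] .
    have cont: "continuous_on {a..b} g"
      using assms(3) ab(1) continuous_on_subset by blast
    have int: "g integrable_on {a..u}" if "u \<in> {a..b}" for u
      using that by (intro integrable_continuous_real continuous_on_subset[OF cont]) auto
    \<comment> \<open>Integrating from the fixed left end \<open>a\<close> removes the case split at
      \<open>s\<close>: on \<open>{a..b}\<close>, \<open>G\<close> differs from such an integral by
      a constant.\<close>
    have G: "G u = integral {a..u} g - integral {a..s} g" if "u \<in> {a..b}" for u
      using Henstock_Kurzweil_Integration.integral_combine[of a s u g]
        Henstock_Kurzweil_Integration.integral_combine[of a u s g] that ab int[OF that] int[OF ab(2)]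
      by (auto simp: G_def algebra_simps)
    have "((\<lambda>u. integral {a..u} g - integral {a..s} g) has_vector_derivative g t - 0) (at t within {a..b})"
      by (intro has_vector_derivative_diff integral_has_vector_derivative cont ab has_vector_derivative_const)
    then have "((\<lambda>u. integral {a..u} g - integral {a..s} g) has_vector_derivative g t) (at t within {a..b})"
      by simp
    then have "(G has_vector_derivative g t) (at t within {a..b})"
      by (rule has_vector_derivative_transform[OF ab(3), rotated]) (use G in auto)
    then show ?thesis
      by (simp add: ab)
  qed
  then show ?thesis
    by (intro that[of G]) (auto simp: G_def)
qed

text \<open>Each integration raises the power of the distance to \<open>s\<close> by one and divides
  by the new exponent; iterated, this yields the factorials in the Picard estimate.\<close>

lemma norm_antiderivative_le_power:
  fixes G :: "real \<Rightarrow> 'a::real_normed_vector"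
  assumes der: "\<And>t. t \<in> {a..b} \<Longrightarrow> (G has_vector_derivative g t) (at t within {a..b})"
    and "s \<in> {a..b}" "G s = 0" "t \<in> {a..b}"
    and bnd: "\<And>t. t \<in> {a..b} \<Longrightarrow> norm (g t) \<le> K * \<bar>t - s\<bar> ^ k"
  shows "norm (G t) \<le> K * \<bar>t - s\<bar> ^ Suc k / Suc k"
proof -
  have cont: "continuous_on {a..b} G"
    using der by (rule continuous_on_vector_derivative)
  have der': "(G has_vector_derivative g x) (at x)" if "a < x" "x < b" for x
    using der[of x] that at_within_Icc_at[of a x b] by auto
  consider "t = s" | "s < t" | "t < s" by linarith
  then show ?thesis
  proof cases
    case 1
    then show ?thesis using assms by simp
  next
    case 2
    let ?\<phi> = "\<lambda>x. K * (x - s) ^ Suc k / Suc k"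
    have "norm (G t - G s) \<le> ?\<phi> t - ?\<phi> s"
    proof (rule differentiable_bound_general[OF 2, where f' = g and \<phi>' = "\<lambda>x. K * (x - s) ^ k"])
      show "continuous_on {s..t} G"
        using assms by (intro continuous_on_subset[OF cont]) auto
      show "continuous_on {s..t} ?\<phi>"
        by (intro continuous_intros) auto
      fix x assume x: "s < x" "x < t"
      show "(G has_vector_derivative g x) (at x)"
        using x assms by (intro der') auto
      show "norm (g x) \<le> K * (x - s) ^ k"
        using bnd[of x] x assms by auto
      have "(?\<phi> has_real_derivative K * (x - s) ^ k) (at x)"
        by (rule derivative_eq_intros refl | simp add: field_simps del: power_Suc of_nat_Suc)+
      then show "(?\<phi> has_vector_derivative K * (x - s) ^ k) (at x)"
        by (simp add: has_real_derivative_iff_has_vector_derivative)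
    qed
    with 2 assms show ?thesis by simp
  next
    case 3
    \<comment> \<open>Left of \<open>s\<close> the minus sign makes the derivative
      \<open>K * (s - x) ^ k\<close>, again the bound on \<open>g\<close>.\<close>
    let ?\<phi> = "\<lambda>x. - (K * (s - x) ^ Suc k / Suc k)"
    have "norm (G s - G t) \<le> ?\<phi> s - ?\<phi> t"
    proof (rule differentiable_bound_general[OF 3, where f' = g and \<phi>' = "\<lambda>x. K * (s - x) ^ k"])
      show "continuous_on {t..s} G"
        using assms by (intro continuous_on_subset[OF cont]) auto
      show "continuous_on {t..s} ?\<phi>"
        by (intro continuous_intros) auto
      fix x assume x: "t < x" "x < s"
      show "(G has_vector_derivative g x) (at x)"
        using x assms by (intro der') auto
      show "norm (g x) \<le> K * (s - x) ^ k"
        using bnd[of x] x assms by auto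
      have "(?\<phi> has_real_derivative K * (s - x) ^ k) (at x)"
        by (rule derivative_eq_intros refl | simp add: field_simps del: power_Suc of_nat_Suc)+
      then show "(?\<phi> has_vector_derivative K * (s - x) ^ k) (at x)"
        by (simp add: has_real_derivative_iff_has_vector_derivative)
    qed
    with 3 assms show ?thesis by simp
  qed
qed

section \<open>Global solutions of linear differential equations\<close>

text \<open>Linearity gives existence on all of \<open>I\<close>, not just near \<open>s\<close>: on
  each compact subinterval the Picard increments are dominated by the terms of an exponential
  series, however large the coefficients are there.\<close>

lemma linear_ode_solution:
  fixes h :: "'b::real_normed_vector \<Rightarrow> 'a::banach \<Rightarrow> 'a"
  assumes h: "bounded_bilinear h" and I: "is_interval I" "s \<in> I" and A: "continuous_on I A"
  obtains X where "X s = c" "\<And>t. t \<in> I \<Longrightarrow> (X has_vector_derivative h (A t) (X t)) (at t within I)"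
proof -
  interpret h: bounded_bilinear h by (rule h)
  \<comment> \<open>Picard iteration, written as the series of its increments \<open>u k\<close>.\<close>
  have "\<exists>u. \<forall>k. ((\<forall>t\<in>I. continuous (at t within I) (u k)) \<and> (k = 0 \<longrightarrow> u k = (\<lambda>_. c))) \<and>
      u (Suc k) s = 0 \<and> (\<forall>t\<in>I. (u (Suc k) has_vector_derivative h (A t) (u k t)) (at t within I))"
  proof (rule dependent_nat_choice)
    show "\<exists>v. (\<forall>t\<in>I. continuous (at t within I) v) \<and> (0 = (0::nat) \<longrightarrow> v = (\<lambda>_. c))"
      by auto
    fix v :: "real \<Rightarrow> 'a" and k :: nat
    assume "(\<forall>t\<in>I. continuous (at t within I) v) \<and> (k = 0 \<longrightarrow> v = (\<lambda>_. c))"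
    then have "continuous_on I v"
      by (simp add: continuous_on_eq_continuous_within)
    then have "continuous_on I (\<lambda>t. h (A t) (v t))"
      by (intro h.continuous_on A)
    then obtain w where "w s = 0" "\<And>t. t \<in> I \<Longrightarrow> (w has_vector_derivative h (A t) (v t)) (at t within I)"
      using interval_antiderivative[OF I] by blast
    then show "\<exists>w. ((\<forall>t\<in>I. continuous (at t within I) w) \<and> (Suc k = 0 \<longrightarrow> w = (\<lambda>_. c))) \<and>
        w s = 0 \<and> (\<forall>t\<in>I. (w has_vector_derivative h (A t) (v t)) (at t within I))"
      by (intro exI[of _ w]) (auto intro: has_vector_derivative_continuous)
  qed
  then obtain u where u0: "u 0 = (\<lambda>_. c)" and us: "\<And>k. u (Suc k) s = 0"
    and du: "\<And>k t. t \<in> I \<Longrightarrow> (u (Suc k) has_vector_derivative h (A t) (u k t)) (at t within I)"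
    by blast
  define X where "X t = (\<Sum>k. u k t)" for t
  \<comment> \<open>\<open>d k\<close> is the derivative of \<open>u k\<close>. As
    \<open>u 0\<close> is constant, the sum of \<open>d k\<close> over \<open>k < Suc n\<close> is
    \<open>h (A t)\<close> applied to the sum of \<open>u k\<close> over
    \<open>k < n\<close>.\<close>
  define d where "d k t = (case k of 0 \<Rightarrow> 0 | Suc j \<Rightarrow> h (A t) (u j t))" for k t
  have d: "(u k has_vector_derivative d k t) (at t within I)" if "t \<in> I" for k t
    using du[OF that] by (cases k) (auto simp: d_def u0 intro!: derivative_eq_intros)
  obtain H where H: "H > 0" "\<And>a x. norm (h a x) \<le> norm a * norm x * H"
    using h.pos_bounded by blast
  have "(X has_vector_derivative h (A t) (X t)) (at t within I)" if t: "t \<in> I" for t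
  proof -
    obtain a b where ab: "{a..b} \<subseteq> I" "s \<in> {a..b}" "t \<in> {a..b}" "at t within {a..b} = at t within I"
      using interval_at_within_Icc[OF I t] .
    have dab: "(u k has_vector_derivative d k x) (at x within {a..b})" if "x \<in> {a..b}" for k x
      using d ab(1) that has_vector_derivative_within_subset by blast
    have "bounded (A ` {a..b})"
      by (intro compact_imp_bounded compact_continuous_image continuous_on_subset[OF A] ab) auto
    then obtain B where B: "B > 0" "\<And>x. x \<in> {a..b} \<Longrightarrow> norm (A x) \<le> B"
      unfolding bounded_pos by auto
    \<comment> \<open>\<open>M\<close> bounds the operator norm of \<open>h (A x)\<close> for all
      \<open>x\<close> in \<open>{a..b}\<close>.\<close>
    define M where "M = B * H"
    have "M > 0" using B H by (simp add: M_def)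
    have M: "norm (h (A x) y) \<le> M * norm y" if "x \<in> {a..b}" for x y
    proof -
      have "norm (h (A x) y) \<le> norm (A x) * (norm y * H)"
        using H(2)[of "A x" y] by (simp add: mult.assoc)
      also have "\<dots> \<le> B * (norm y * H)"
        using B(2)[OF that] H(1) by (intro mult_right_mono) auto
      finally show ?thesis by (simp add: M_def mult_ac)
    qed
    have bound: "norm (u k x) \<le> (norm c * M ^ k / fact k) * \<bar>x - s\<bar> ^ k" if "x \<in> {a..b}" for k x
      using that
    proof (induction k arbitrary: x)
      case 0
      then show ?case by (simp add: u0)
    next
      case (Suc k)
      have "norm (u (Suc k) x) \<le> (M * (norm c * M ^ k / fact k)) * \<bar>x - s\<bar> ^ Suc k / Suc k"
      proof (rule norm_antiderivative_le_power[OF dab ab(2) us Suc.prems])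
        fix y assume y: "y \<in> {a..b}"
        have "norm (d (Suc k) y) \<le> M * norm (u k y)"
          using M[OF y] by (simp add: d_def)
        also have "\<dots> \<le> M * ((norm c * M ^ k / fact k) * \<bar>y - s\<bar> ^ k)"
          using Suc.IH[OF y] \<open>M > 0\<close> by (intro mult_left_mono) auto
        finally show "norm (d (Suc k) y) \<le> (M * (norm c * M ^ k / fact k)) * \<bar>y - s\<bar> ^ k"
          by (simp add: mult_ac)
      qed
      also have "\<dots> = (norm c * M ^ Suc k / fact (Suc k)) * \<bar>x - s\<bar> ^ Suc k"
        by (simp add: field_simps)
      finally show ?case .
    qed
    have unif: "uniform_limit {a..b} (\<lambda>n x. \<Sum>k<n. u k x) X sequentially"
      unfolding X_def
    proof (rule Weierstrass_m_test)
      fix k x assume x: "x \<in> {a..b}"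
      have "(norm c * M ^ k / fact k) * \<bar>x - s\<bar> ^ k \<le> (norm c * M ^ k / fact k) * (b - a) ^ k"
        using x ab \<open>M > 0\<close> by (intro mult_left_mono power_mono) auto
      also have "\<dots> = norm c * ((M * (b - a)) ^ k /\<^sub>R fact k)"
        by (simp add: power_mult_distrib divide_inverse_commute mult_ac)
      finally show "norm (u k x) \<le> norm c * ((M * (b - a)) ^ k /\<^sub>R fact k)"
        using bound[OF x, of k] by linarith
    next
      show "summable (\<lambda>k. norm c * ((M * (b - a)) ^ k /\<^sub>R fact k))"
        by (intro summable_mult summable_exp_generic)
    qed
    have sums: "(\<lambda>k. u k x) sums X x" if "x \<in> {a..b}" for x
      using tendsto_uniform_limitI[OF unif that] by (simp add: sums_def)
    \<comment> \<open>Termwise differentiation requires the differentiated series to converge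
      uniformly. It does, because \<open>h (A x)\<close> turns an error below \<open>e / M\<close>
      in the partial sums of \<open>u\<close> into one of at most \<open>e\<close>.\<close>
    have "\<exists>g. \<forall>x\<in>{a..b}. (\<lambda>k. u k x) sums g x \<and>
        (g has_derivative (\<lambda>r. r *\<^sub>R h (A x) (X x))) (at x within {a..b})"
    proof (rule has_derivative_series)
      show "convex {a..b}" by simp
      show "(u k has_derivative (\<lambda>r. r *\<^sub>R d k x)) (at x within {a..b})" if "x \<in> {a..b}" for k x
        using dab[OF that] by (simp add: has_vector_derivative_def)
      show "(\<lambda>k. u k t) sums X t" "t \<in> {a..b}"
        using sums ab by auto
      fix e :: real assume "e > 0"
      then have "e / M > 0" using \<open>M > 0\<close> by simp
      then have "\<forall>\<^sub>F n in sequentially. \<forall>x\<in>{a..b}. dist (\<Sum>k<n. u k x) (X x) < e / M"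
        using unif unfolding uniform_limit_iff by blast
      then have "\<forall>\<^sub>F n in sequentially. \<forall>x\<in>{a..b}. \<forall>r. norm ((\<Sum>k<Suc n. r *\<^sub>R d k x) - r *\<^sub>R h (A x) (X x)) \<le> e * norm r"
      proof eventually_elim
        case (elim n)
        show ?case
        proof (intro ballI allI)
          fix x r assume x: "x \<in> {a..b}"
          have "(\<Sum>k<Suc n. r *\<^sub>R d k x) - r *\<^sub>R h (A x) (X x) = r *\<^sub>R h (A x) ((\<Sum>k<n. u k x) - X x)"
            by (simp add: sum.lessThan_Suc_shift d_def scaleR_sum_right[symmetric] scaleR_diff_right
                h.sum_right h.diff_right del: sum.lessThan_Suc)
          also have "norm \<dots> \<le> \<bar>r\<bar> * (M * norm ((\<Sum>k<n. u k x) - X x))"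
            using M[OF x] by (simp add: mult_left_mono)
          also have "\<dots> \<le> \<bar>r\<bar> * (M * (e / M))"
            using elim x \<open>M > 0\<close> by (intro mult_left_mono) (auto simp: dist_norm less_imp_le)
          finally show "norm ((\<Sum>k<Suc n. r *\<^sub>R d k x) - r *\<^sub>R h (A x) (X x)) \<le> e * norm r"
            using \<open>M > 0\<close> by (simp add: mult.commute)
        qed
      qed
      then show "\<forall>\<^sub>F n in sequentially. \<forall>x\<in>{a..b}. \<forall>r. norm ((\<Sum>k<n. r *\<^sub>R d k x) - r *\<^sub>R h (A x) (X x)) \<le> e * norm r"
        by (subst (asm) eventually_sequentially_Suc)
    qed
    then obtain g where g: "\<And>x. x \<in> {a..b} \<Longrightarrow> (\<lambda>k. u k x) sums g x"
      "\<And>x. x \<in> {a..b} \<Longrightarrow> (g has_vector_derivative h (A x) (X x)) (at x within {a..b})"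
      unfolding has_vector_derivative_def by blast
    then have "X x = g x" if "x \<in> {a..b}" for x
      using sums that sums_unique2 by blast
    then have "(X has_vector_derivative h (A t) (X t)) (at t within {a..b})"
      using g(2)[OF ab(3)] by (intro has_vector_derivative_transform[OF ab(3), of X g]) auto
    then show ?thesis by (simp add: ab)
  qed
  moreover have "X s = c"
  proof -
    have "(\<lambda>k. u k s) = (\<lambda>k. if k = 0 then c else 0)"
    proof
      show "u k s = (if k = 0 then c else 0)" for k
        by (cases k) (auto simp: u0 us)
    qed
    then show ?thesis
      using sums_single[of 0 "\<lambda>_. c"] by (simp add: X_def sums_iff)
  qed
  ultimately show ?thesis
    using that by blast
qed

section \<open>Smoothness from closure under differentiation\<close>

text \<open>Successive derivatives can be chosen without ever leaving \<open>S\<close>, so no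
  formula for the \<open>k\<close>-th derivative has to be found.\<close>

lemma smooth_map_on_if_closed_under_derivative:
  assumes "f \<in> S"
    and closed: "\<And>g. g \<in> S \<Longrightarrow> \<exists>g'\<in>S. \<forall>t\<in>I. (g has_vector_derivative g' t) (at t within I)"
  shows "smooth_map_on I f"
proof -
  \<comment> \<open>The clause for \<open>k = 0\<close> makes the chosen sequence start at
    \<open>f\<close>.\<close>
  have "\<exists>D. \<forall>k. (D k \<in> S \<and> (k = 0 \<longrightarrow> D k = f)) \<and>
      (\<forall>t\<in>I. (D k has_vector_derivative D (Suc k) t) (at t within I))"
  proof (rule dependent_nat_choice)
    show "\<exists>g. g \<in> S \<and> (0 = (0::nat) \<longrightarrow> g = f)"
      using assms(1) by blast
    show "\<exists>g'. (g' \<in> S \<and> (Suc k = 0 \<longrightarrow> g' = f)) \<and>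
        (\<forall>t\<in>I. (g has_vector_derivative g' t) (at t within I))"
      if "g \<in> S \<and> (k = 0 \<longrightarrow> g = f)" for g and k :: nat
      using closed that by blast
  qed
  then show ?thesis
    unfolding smooth_map_on_def by blast
qed

lemma smooth_map_on_componentwise:
  fixes f :: "real \<Rightarrow> 'a::euclidean_space"
  assumes "\<And>b. b \<in> Basis \<Longrightarrow> smooth_map_on I (\<lambda>t. f t \<bullet> b)"
  shows "smooth_map_on I f"
proof -
  have "\<forall>b\<in>Basis. \<exists>D. D 0 = (\<lambda>t. f t \<bullet> b) \<and>
      (\<forall>k. \<forall>t\<in>I. (D k has_vector_derivative D (Suc k) t) (at t within I))"
    using assms unfolding smooth_map_on_def by blast
  then obtain D where D0: "\<And>b. b \<in> Basis \<Longrightarrow> D b 0 = (\<lambda>t. f t \<bullet> b)"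
    and D: "\<And>b k t. b \<in> Basis \<Longrightarrow> t \<in> I \<Longrightarrow> (D b k has_vector_derivative D b (Suc k) t) (at t within I)"
    by metis
  show ?thesis
    unfolding smooth_map_on_def
  proof (intro exI[of _ "\<lambda>k t. \<Sum>b\<in>Basis. D b k t *\<^sub>R b"] conjI allI ballI)
    show "(\<lambda>t. \<Sum>b\<in>Basis. D b 0 t *\<^sub>R b) = f"
      by (simp add: D0 euclidean_representation)
    fix k t assume "t \<in> I"
    then show "((\<lambda>t. \<Sum>b\<in>Basis. D b k t *\<^sub>R b) has_vector_derivative
        (\<Sum>b\<in>Basis. D b (Suc k) t *\<^sub>R b)) (at t within I)"
      by (intro has_vector_derivative_sum bounded_linear.has_vector_derivative[OF bounded_linear_scaleR_left] D)
  qed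
qed

text \<open>The polynomials with real coefficients in the members of \<open>G\<close>.\<close>

inductive_set generated_algebra :: "('b \<Rightarrow> real) set \<Rightarrow> ('b \<Rightarrow> real) set" for G where
  gen: "g \<in> G \<Longrightarrow> g \<in> generated_algebra G"
| const: "(\<lambda>_. c) \<in> generated_algebra G"
| add: "f \<in> generated_algebra G \<Longrightarrow> g \<in> generated_algebra G \<Longrightarrow> (\<lambda>t. f t + g t) \<in> generated_algebra G"
| mult: "f \<in> generated_algebra G \<Longrightarrow> g \<in> generated_algebra G \<Longrightarrow> (\<lambda>t. f t * g t) \<in> generated_algebra G"

text \<open>By the sum and product rules, closure under differentiation has to be checked on the
  generators only.\<close>

lemma smooth_map_on_generated_algebra:
  assumes G: "\<And>g. g \<in> G \<Longrightarrow> \<exists>g'\<in>generated_algebra G. \<forall>t\<in>I. (g has_vector_derivative g' t) (at t within I)"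
    and "f \<in> generated_algebra G"
  shows "smooth_map_on I f"
  using assms(2)
proof (rule smooth_map_on_if_closed_under_derivative)
  fix g assume "g \<in> generated_algebra G"
  then show "\<exists>g'\<in>generated_algebra G. \<forall>t\<in>I. (g has_vector_derivative g' t) (at t within I)"
  proof induction
    case (gen g)
    then show ?case by (rule G)
  next
    case (const c)
    show ?case
      by (intro bexI[of _ "\<lambda>_. 0"] generated_algebra.const) auto
  next
    case (add f g)
    then obtain f' g' where "f' \<in> generated_algebra G" "g' \<in> generated_algebra G"
      "\<forall>t\<in>I. (f has_vector_derivative f' t) (at t within I)"
      "\<forall>t\<in>I. (g has_vector_derivative g' t) (at t within I)" by blast
    then show ?case
      by (intro bexI[of _ "\<lambda>t. f' t + g' t"] generated_algebra.add)
        (auto intro: has_vector_derivative_add)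
  next
    case (mult f g)
    then obtain f' g' where "f' \<in> generated_algebra G" "g' \<in> generated_algebra G"
      "\<forall>t\<in>I. (f has_vector_derivative f' t) (at t within I)"
      "\<forall>t\<in>I. (g has_vector_derivative g' t) (at t within I)" by blast
    with mult.hyps show ?case
      by (intro bexI[of _ "\<lambda>t. f t * g' t + f' t * g t"] generated_algebra.add generated_algebra.mult)
        (auto intro: has_vector_derivative_mult)
  qed
qed

section \<open>Algebra of pseudo-orthonormal frames\<close>

lemma bounded_bilinear_matrix_mult:
  "bounded_bilinear ((**) :: real ^ 'n ^ 'm \<Rightarrow> real ^ 'p ^ 'n \<Rightarrow> real ^ 'p ^ 'm)"
  unfolding bilinear_conv_bounded_bilinear[symmetric] bilinear_def
  by (auto simp: linear_iff matrix_matrix_mult_def vec_eq_iff algebra_simps sum.distrib sum_distrib_left)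

definition diag_mat :: "'a::zero ^ 'n \<Rightarrow> 'a ^ 'n ^ 'n"
  where "diag_mat d = (\<chi> i j. if i = j then d $ i else 0)"

lemma diag_mat_nth: "diag_mat d $ i $ j = (if i = j then d $ i else 0)"
  by (simp add: diag_mat_def)

lemma det_diag_mat: "det (diag_mat d) = (\<Prod>i\<in>UNIV. d $ i)"
  by (subst det_diagonal) (auto simp: diag_mat_nth)

lemma diag_mat_mult_diag_mat:
  fixes d e :: "'a::comm_semiring_1 ^ 'n"
  shows "diag_mat d ** diag_mat e = diag_mat (\<chi> i. d $ i * e $ i)"
  by (simp add: vec_eq_iff matrix_matrix_mult_def diag_mat_nth if_distrib[of "\<lambda>x. x * _"] cong: if_cong)

lemma transpose_diag_mat_mult_nth:
  fixes F :: "'a::comm_semiring_1 ^ 'n ^ 'm"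
  shows "(transpose F ** diag_mat d ** F) $ i $ j = (\<Sum>k\<in>UNIV. d $ k * F $ k $ i * F $ k $ j)"
  by (simp add: matrix_matrix_mult_def diag_mat_nth transpose_def if_distrib mult_ac cong: if_cong)

lemma mult_diag_mat_transpose_nth:
  fixes F :: "'a::comm_semiring_1 ^ 'n ^ 'm"
  shows "(F ** diag_mat d ** transpose F) $ i $ j = (\<Sum>k\<in>UNIV. d $ k * F $ i $ k * F $ j $ k)"
  by (simp add: matrix_matrix_mult_def diag_mat_nth transpose_def if_distrib mult_ac cong: if_cong)

abbreviation metric_mat :: "real ^ 4 ^ 4"
  where "metric_mat \<equiv> diag_mat (vector [-1, -1, 1, 1])"

text \<open>The values of \<open>ip\<close> on the frame \<mu>, \<gamma>, \<open>v1\<close>,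
  \<open>v2\<close>: \<mu> is spacelike, \<gamma> timelike, and \<open>v1\<close>, \<open>v2\<close>
  have opposite signs \<epsilon> and -\<epsilon>.\<close>

abbreviation gram_mat :: "real \<Rightarrow> real ^ 4 ^ 4"
  where "gram_mat \<epsilon> \<equiv> diag_mat (vector [1, -1, \<epsilon>, - \<epsilon>])"

lemma diag_mat_1: "diag_mat (\<chi> i. 1) = (mat 1 :: 'a::zero_neq_one ^ 'n ^ 'n)"
  by (simp add: vec_eq_iff mat_def diag_mat_nth)

lemma prod_4: "prod f (UNIV :: 4 set) = f 1 * f 2 * f 3 * f 4"
  unfolding UNIV_4 by (simp add: ac_simps)

lemma metric_mat_square: "metric_mat ** metric_mat = mat 1"
  unfolding diag_mat_mult_diag_mat diag_mat_1[symmetric]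
  by (rule arg_cong[where f = diag_mat]) (simp add: vec_eq_iff forall_4)

lemma gram_mat_square:
  assumes "\<epsilon>\<^sup>2 = 1"
  shows "gram_mat \<epsilon> ** gram_mat \<epsilon> = mat 1"
  unfolding diag_mat_mult_diag_mat diag_mat_1[symmetric] using assms
  by (intro arg_cong[where f = diag_mat]) (simp add: vec_eq_iff forall_4 power2_eq_square)

text \<open>Take determinants: \<open>gram_mat \<epsilon>\<close> has determinant \<epsilon>^2 = 1,
  and \<open>metric_mat\<close> has determinant 1.\<close>

lemma frame_det:
  assumes "\<epsilon>\<^sup>2 = 1" "transpose F ** gram_mat \<epsilon> ** F = metric_mat"
  shows "(det F)\<^sup>2 = 1"
proof -
  have "det (transpose F ** gram_mat \<epsilon> ** F) = det metric_mat"
    using assms(2) by simp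
  then show ?thesis
    using assms(1) by (simp add: det_mul det_diag_mat prod_4 power2_eq_square)
qed

text \<open>Columns being orthonormal turns into rows being orthonormal because a left inverse of a square
  matrix is a right inverse.\<close>

lemma frame_gram:
  assumes \<epsilon>: "\<epsilon>\<^sup>2 = 1" and F: "transpose F ** gram_mat \<epsilon> ** F = metric_mat"
  shows "ip (F $ i) (F $ j) = gram_mat \<epsilon> $ i $ j"
proof -
  \<comment> \<open>Since \<open>metric_mat\<close> is its own inverse, the hypothesis exhibits a
    left inverse of \<open>F\<close>.\<close>
  have "(metric_mat ** (transpose F ** gram_mat \<epsilon>)) ** F = mat 1"
    using F metric_mat_square by (simp add: matrix_mul_assoc[symmetric])
  then have "F ** (metric_mat ** (transpose F ** gram_mat \<epsilon>)) = mat 1"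
    using matrix_left_right_inverse by blast
  then have "(F ** metric_mat ** transpose F) ** gram_mat \<epsilon> = mat 1"
    by (simp add: matrix_mul_assoc)
  then have "((F ** metric_mat ** transpose F) ** gram_mat \<epsilon>) ** gram_mat \<epsilon> = gram_mat \<epsilon>"
    by simp
  then have "F ** metric_mat ** transpose F = gram_mat \<epsilon>"
    by (simp add: matrix_mul_assoc[symmetric] gram_mat_square[OF \<epsilon>])
  then have "(F ** metric_mat ** transpose F) $ i $ j = gram_mat \<epsilon> $ i $ j"
    by simp
  then show ?thesis
    unfolding mult_diag_mat_transpose_nth by (simp add: sum_4 ip_def)
qed

lemma initial_frame:
  assumes "\<epsilon>\<^sup>2 = 1"
  obtains F where "transpose F ** gram_mat \<epsilon> ** F = metric_mat" "det F = 1"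
proof -
  have "\<epsilon> = 1 \<or> \<epsilon> = -1"
    using assms by (simp add: power2_eq_1_iff)
  \<comment> \<open>The standard basis has signs -, -, +, +. It is permuted to +, -, +, - for
    \<epsilon> = 1 and to +, -, -, + for \<epsilon> = -1.\<close>
  then have "\<exists>F. transpose F ** gram_mat \<epsilon> ** F = metric_mat"
  proof
    assume "\<epsilon> = 1"
    then show ?thesis
      by (intro exI[of _ "vector [axis 4 1, axis 1 1, axis 3 1, axis 2 1]"])
        (simp add: vec_eq_iff forall_4 transpose_diag_mat_mult_nth sum_4 diag_mat_nth axis_def)
  next
    assume "\<epsilon> = -1"
    then show ?thesis
      by (intro exI[of _ "vector [axis 4 1, axis 1 1, axis 2 1, axis 3 1]"])
        (simp add: vec_eq_iff forall_4 transpose_diag_mat_mult_nth sum_4 diag_mat_nth axis_def)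
  qed
  then obtain E where E: "transpose E ** gram_mat \<epsilon> ** E = metric_mat" by blast
  have det: "(det E)\<^sup>2 = 1"
    using assms E by (rule frame_det)
  \<comment> \<open>Scaling the first row by \<open>det E\<close>, which is 1 or -1, corrects the
    orientation; the relation survives because that row enters it quadratically.\<close>
  define F where "F = diag_mat (vector [det E, 1, 1, 1]) ** E"
  have "transpose F ** gram_mat \<epsilon> ** F = transpose E ** gram_mat \<epsilon> ** E"
  proof -
    have F_nth: "F $ i = (if i = 1 then det E *\<^sub>R E $ i else E $ i)" for i
      using exhaust_4[of i]
      by (auto simp: F_def matrix_matrix_mult_def diag_mat_nth vec_eq_iff if_distrib[of "\<lambda>x. x * _"] cong: if_cong)
    have "det E * (det E * x) = x" for x
      using det by (simp add: power2_eq_square mult.assoc[symmetric])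
    then show ?thesis
      by (simp add: vec_eq_iff transpose_diag_mat_mult_nth sum_4 F_nth mult_ac)
  qed
  moreover have "det F = 1"
    using det by (simp add: F_def det_mul det_diag_mat prod_4 power2_eq_square)
  ultimately show ?thesis
    using E that by simp
qed

text \<open>Both sides have the same \<open>ip\<close> with every row of \<open>F\<close>: with row
  1 it is \<open>det F\<close> = 1, with the others it is 0, the determinant having a repeated row.
  The rows span and \<open>ip\<close> is nondegenerate, so the sides agree.\<close>

lemma frame_triple:
  assumes \<epsilon>: "\<epsilon>\<^sup>2 = 1" and F: "transpose F ** gram_mat \<epsilon> ** F = metric_mat" and "det F = 1"
  shows "triple (F $ 2) (F $ 3) (F $ 4) = F $ 1"
proof -
  define w where "w = triple (F $ 2) (F $ 3) (F $ 4) - F $ 1"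
  have F_rows: "vector [F $ 1, F $ 2, F $ 3, F $ 4] = F"
    by (simp add: vec_eq_iff forall_4)
  have repeated: "det (vector [F $ i, F $ 2, F $ 3, F $ 4] :: real ^ 4 ^ 4) = 0" if "i \<noteq> 1" for i
    using that exhaust_4[of i]
    by (intro det_identical_rows[of 1 i]) (auto simp: row_def)
  have "ip (F $ i) (triple (F $ 2) (F $ 3) (F $ 4)) = ip (F $ i) (F $ 1)" for i
    using repeated[of i] \<open>det F = 1\<close> F_rows
    by (cases "i = 1") (simp_all add: ip_triple frame_gram[OF \<epsilon> F] diag_mat_nth)
  moreover have "ip (F $ i) w = ip (F $ i) (triple (F $ 2) (F $ 3) (F $ 4)) - ip (F $ i) (F $ 1)" for i
    by (simp add: w_def ip_def right_diff_distrib)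
  ultimately have ip_w: "ip (F $ i) w = 0" for i
    by simp
  \<comment> \<open>The entries of this vector are the products \<open>ip (F $ i) w\<close>.\<close>
  have "F *v (metric_mat *v w) = 0"
    using ip_w
    by (simp add: vec_eq_iff matrix_vector_mult_def diag_mat_nth sum_4 ip_def if_distrib[of "\<lambda>x. x * _"] cong: if_cong)
  moreover have "invertible F"
    using \<open>det F = 1\<close> by (simp add: invertible_det_nz)
  ultimately have "metric_mat *v w = 0"
    by (metis invertible_left_inverse matrix_left_invertible_ker)
  then have "metric_mat *v (metric_mat *v w) = 0"
    by simp
  then have "w = 0"
    by (simp add: matrix_vector_mul_assoc metric_mat_square)
  then show ?thesis
    by (simp add: w_def)
qed

section \<open>Invariants of the structure equations\<close>

text \<open>The rows of a frame matrix are \<open>\<mu>\<close>, \<open>\<gamma>\<close>, \<open>v1\<close>, \<open>v2\<close> in this order, so that a positively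
  oriented frame has \<open>\<mu> = triple \<gamma> v1 v2\<close>.\<close>

definition frenet_mat :: "real \<Rightarrow> real \<Rightarrow> real \<Rightarrow> real \<Rightarrow> real \<Rightarrow> real ^ 4 ^ 4"
  where "frenet_mat \<epsilon> a l m n = vector
    [vector [0, a, - \<epsilon> * m, \<epsilon> * n],
     vector [a, 0, 0, 0],
     vector [m, 0, 0, l],
     vector [n, 0, l, 0]]"

lemma ip_add_left: "ip (u + v) w = ip u w + ip v w"
  and ip_scaleR_left: "ip (c *\<^sub>R u) w = c * ip u w"
  by (simp_all add: ip_def algebra_simps)

lemma frenet_frame_gram_constant:
  assumes "is_interval I" "s \<in> I" "t \<in> I"
    and F: "\<And>t. t \<in> I \<Longrightarrow>
      (F has_vector_derivative frenet_mat \<epsilon> (\<alpha> t) (l t) (m t) (n t) ** F t) (at t within I)"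
  shows "transpose (F t) ** gram_mat \<epsilon> ** F t = transpose (F s) ** gram_mat \<epsilon> ** F s"
proof -
  have "(transpose (F t) ** gram_mat \<epsilon> ** F t) $ i $ j = (transpose (F s) ** gram_mat \<epsilon> ** F s) $ i $ j"
    for i j
  proof -
    \<comment> \<open>\<open>Q\<close> is one entry of
      \<open>transpose F ** gram_mat \<epsilon> ** F\<close> written out; after the product rule its
      terms cancel in pairs, as \<open>gram_mat \<epsilon> ** frenet_mat \<epsilon> a l m n\<close>
      is skew-symmetric.\<close>
    define Q where "Q u = F u $ 1 $ i * F u $ 1 $ j - F u $ 2 $ i * F u $ 2 $ j
      + \<epsilon> * (F u $ 3 $ i * F u $ 3 $ j) - \<epsilon> * (F u $ 4 $ i * F u $ 4 $ j)" for u
    have Q: "(transpose (F u) ** gram_mat \<epsilon> ** F u) $ i $ j = Q u" for u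
      by (simp add: transpose_diag_mat_mult_nth sum_4 Q_def mult_ac)
    have "(Q has_vector_derivative 0) (at u within I)" if u: "u \<in> I" for u
    proof -
      have *: "((\<lambda>u. F u $ k $ i) has_real_derivative
          (frenet_mat \<epsilon> (\<alpha> u) (l u) (m u) (n u) ** F u) $ k $ i) (at u within I)" for k i
        unfolding has_real_derivative_iff_has_vector_derivative
        by (intro bounded_linear.has_vector_derivative[OF bounded_linear_vec_nth] F u)
      show ?thesis
        unfolding has_real_derivative_iff_has_vector_derivative[symmetric] Q_def
        by (rule derivative_eq_intros * refl)+
          (simp add: frenet_mat_def matrix_matrix_mult_def sum_4 algebra_simps)
    qed
    then have "Q t = Q s"
      using has_vector_derivative_zero_constant[of I Q] assms(1-3) is_interval_convex_1 by metis
    then show ?thesis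
      by (simp add: Q)
  qed
  then show ?thesis
    by (simp add: vec_eq_iff)
qed

text \<open>A continuous function with finitely many values on a connected set is constant.\<close>

lemma det_constant_if_square_1:
  assumes "is_interval I" "s \<in> I" "t \<in> I" "continuous_on I F"
    and "\<And>t. t \<in> I \<Longrightarrow> (det (F t :: real ^ 'n ^ 'n))\<^sup>2 = 1"
  shows "det (F t) = det (F s)"
proof -
  have "continuous_on I (\<lambda>t. det (F t))"
    unfolding det_def by (intro continuous_intros assms)
  moreover have "(\<lambda>t. det (F t)) ` I \<subseteq> {-1, 1}"
    using assms(5) by (auto simp: power2_eq_1_iff)
  then have "finite ((\<lambda>t. det (F t)) ` I)"
    using finite_subset by blast
  ultimately have "(\<lambda>t. det (F t)) constant_on I"
    using assms(1) by (intro continuous_finite_range_constant) (auto simp: is_interval_connected)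
  then show ?thesis
    using assms(2,3) unfolding constant_on_def by metis
qed

section \<open>Construction of the framed curve with prescribed curvature\<close>

theorem theorem3p2:
  fixes I :: "real set" and \<alpha> l m n :: "real \<Rightarrow> real"
    and \<Delta> :: "((real ^ 4) \<times> (real ^ 4)) set"
  assumes "is_interval I" and "interior I \<noteq> {}"
    and "smooth_map_on I (\<lambda>t. (\<alpha> t, l t, m t, n t))"
    and "\<Delta> = Delta1_AdS_S \<or> \<Delta> = Delta1_S_AdS"
  shows "\<exists>\<gamma> v1 v2. ps_spacelike_framed_curve \<Delta> I \<gamma> v1 v2 \<and>
    (\<forall>t\<in>I. curvature I \<gamma> v1 v2 t = (\<alpha> t, l t, m t, n t))"
proof -
  \<comment> \<open>The sign \<epsilon> of \<open>v1\<close> treats both forms of \<Delta> at once: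
    -1 for \<open>Delta1_AdS_S\<close>, 1 for \<open>Delta1_S_AdS\<close>.\<close>
  have "\<exists>\<epsilon>. \<epsilon>\<^sup>2 = 1 \<and> \<Delta> = {(u, w). ip u u = \<epsilon> \<and> ip w w = - \<epsilon> \<and> ip u w = 0}"
    using assms(4)
  proof
    assume "\<Delta> = Delta1_AdS_S"
    then show ?thesis
      by (intro exI[of _ "-1"]) (auto simp: Delta1_AdS_S_def AdS3_def S32_def)
  next
    assume "\<Delta> = Delta1_S_AdS"
    then show ?thesis
      by (intro exI[of _ 1]) (auto simp: Delta1_S_AdS_def AdS3_def S32_def)
  qed
  then obtain \<epsilon> where \<epsilon>: "\<epsilon>\<^sup>2 = 1"
    and \<Delta>: "\<Delta> = {(u, w). ip u u = \<epsilon> \<and> ip w w = - \<epsilon> \<and> ip u w = 0}"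
    by blast
  obtain D where D0: "D 0 = (\<lambda>t. (\<alpha> t, l t, m t, n t))"
    and D: "\<And>k t. t \<in> I \<Longrightarrow> (D k has_vector_derivative D (Suc k) t) (at t within I)"
    using assms(3) unfolding smooth_map_on_def by blast
  obtain s where s: "s \<in> interior I"
    using assms(2) by blast
  then have "s \<in> I"
    using interior_subset by blast
  define A where "A t = frenet_mat \<epsilon> (\<alpha> t) (l t) (m t) (n t)" for t
  have *: "continuous_on I (\<lambda>t. (\<alpha> t, l t, m t, n t))"
    using D[of _ 0] unfolding D0 by (rule continuous_on_vector_derivative)
  have cont: "continuous_on I \<alpha>" "continuous_on I l" "continuous_on I m" "continuous_on I n"
    using continuous_on_fst[OF *] continuous_on_fst[OF continuous_on_snd[OF *]]
      continuous_on_fst[OF continuous_on_snd[OF continuous_on_snd[OF *]]]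
      continuous_on_snd[OF continuous_on_snd[OF continuous_on_snd[OF *]]] by simp_all
  have "continuous_on I (\<lambda>t. A t $ i $ j)" for i j
    using exhaust_4[of i] exhaust_4[of j]
    by (elim disjE; simp add: A_def frenet_mat_def; intro continuous_intros cont)
  then have "continuous_on I (\<lambda>t. \<chi> i j. A t $ i $ j)"
    by (intro continuous_on_vec_lambda)
  then have "continuous_on I A"
    by simp
  obtain F0 where F0: "transpose F0 ** gram_mat \<epsilon> ** F0 = metric_mat" "det F0 = 1"
    using initial_frame[OF \<epsilon>] .
  obtain F where Fs: "F s = F0"
    and dF: "\<And>t. t \<in> I \<Longrightarrow> (F has_vector_derivative A t ** F t) (at t within I)"
    using linear_ode_solution[OF bounded_bilinear_matrix_mult assms(1) \<open>s \<in> I\<close> \<open>continuous_on I A\<close>] by blast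
  have F: "transpose (F t) ** gram_mat \<epsilon> ** F t = metric_mat" if "t \<in> I" for t
    using frenet_frame_gram_constant[OF assms(1) \<open>s \<in> I\<close> that dF[unfolded A_def]] F0 Fs by simp
  have "continuous_on I F"
    using dF by (rule continuous_on_vector_derivative)
  then have detF: "det (F t) = 1" if "t \<in> I" for t
    using det_constant_if_square_1[OF assms(1) \<open>s \<in> I\<close> that \<open>continuous_on I F\<close> frame_det[OF \<epsilon> F]] F0 Fs by simp
  have gram: "ip (F t $ i) (F t $ j) = gram_mat \<epsilon> $ i $ j" if "t \<in> I" for t i j
    using frame_gram[OF \<epsilon> F[OF that]] .
  have triple: "triple (F t $ 2) (F t $ 3) (F t $ 4) = F t $ 1" if "t \<in> I" for t
    using frame_triple[OF \<epsilon> F[OF that] detF[OF that]] .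
  have drow: "((\<lambda>t. F t $ i) has_vector_derivative (A t ** F t) $ i) (at t within I)" if "t \<in> I" for t i
    by (intro bounded_linear.has_vector_derivative[OF bounded_linear_vec_nth] dF that)
  \<comment> \<open>Derivatives within \<open>I\<close> are unique only at limit points of
    \<open>I\<close>; the nonempty interior excludes a one-point interval. This lets
    \<open>deriv_on\<close> be read off from the differential equation.\<close>
  have nontrivial: "at t within I \<noteq> bot" if "t \<in> I" for t
  proof -
    have "\<not> (\<exists>x. I = {x})"
      using s by (metis empty_iff interior_singleton)
    then show ?thesis
      using that assms(1) by (simp add: trivial_limit_within connected_imp_perfect is_interval_connected)
  qed
  have deriv: "deriv_on I (\<lambda>t. F t $ i) t = (\<Sum>k\<in>UNIV. A t $ i $ k *\<^sub>R F t $ k)" if "t \<in> I" for t i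
    using vector_derivative_within[OF nontrivial[OF that] drow[OF that]]
    by (simp add: vec_eq_iff matrix_matrix_mult_def)
  \<comment> \<open>Index \<open>k = 0\<close> supplies the curvature functions themselves, hence
    all entries of \<open>A\<close>; all \<open>k\<close> together make their derivatives generators
    too.\<close>
  define G where "G = range (\<lambda>k t. fst (D k t)) \<union> range (\<lambda>k t. fst (snd (D k t)))
    \<union> range (\<lambda>k t. fst (snd (snd (D k t)))) \<union> range (\<lambda>k t. snd (snd (snd (D k t))))
    \<union> range (\<lambda>(i, j) t. F t $ i $ j)"
  have in_G: "(\<lambda>t. fst (D k t)) \<in> generated_algebra G" "(\<lambda>t. fst (snd (D k t))) \<in> generated_algebra G"
    "(\<lambda>t. fst (snd (snd (D k t)))) \<in> generated_algebra G" "(\<lambda>t. snd (snd (snd (D k t)))) \<in> generated_algebra G"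
    "(\<lambda>t. F t $ i $ j) \<in> generated_algebra G" for k i j
    by (auto simp: G_def image_iff intro!: generated_algebra.gen)
  have "\<alpha> \<in> generated_algebra G" "l \<in> generated_algebra G" "m \<in> generated_algebra G" "n \<in> generated_algebra G"
    using in_G(1-4)[of 0] by (simp_all add: D0)
  moreover have "(\<lambda>t. \<epsilon> * n t) \<in> generated_algebra G" "(\<lambda>t. - \<epsilon> * m t) \<in> generated_algebra G"
    by (intro generated_algebra.mult[OF generated_algebra.const] calculation)+
  ultimately have A_in_G: "(\<lambda>t. A t $ i $ j) \<in> generated_algebra G" for i j
    using exhaust_4[of i] exhaust_4[of j]
    by (elim disjE; simp add: A_def frenet_mat_def generated_algebra.const)
  have G_closed: "\<exists>g'\<in>generated_algebra G. \<forall>t\<in>I. (g has_vector_derivative g' t) (at t within I)"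
    if g: "g \<in> G" for g
  proof -
    note blin = bounded_linear.has_vector_derivative
    note fst = blin[OF bounded_linear_fst] and snd = blin[OF bounded_linear_snd]
    consider k where "g = (\<lambda>t. fst (D k t))" | k where "g = (\<lambda>t. fst (snd (D k t)))"
      | k where "g = (\<lambda>t. fst (snd (snd (D k t))))" | k where "g = (\<lambda>t. snd (snd (snd (D k t))))"
      | i j where "g = (\<lambda>t. F t $ i $ j)"
      using g unfolding G_def by auto
    then show ?thesis
    proof cases
      case (1 k)
      show ?thesis
        unfolding 1 by (intro bexI[OF _ in_G(1)[of "Suc k"]] ballI fst D)
    next
      case (2 k)
      show ?thesis
        unfolding 2 by (intro bexI[OF _ in_G(2)[of "Suc k"]] ballI fst snd D)
    next
      case (3 k)
      show ?thesis
        unfolding 3 by (intro bexI[OF _ in_G(3)[of "Suc k"]] ballI fst snd D)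
    next
      case (4 k)
      show ?thesis
        unfolding 4 by (intro bexI[OF _ in_G(4)[of "Suc k"]] ballI snd D)
    next
      case (5 i j)
      show ?thesis
      proof (rule bexI, rule ballI)
        show "(g has_vector_derivative (A t ** F t) $ i $ j) (at t within I)" if "t \<in> I" for t
          unfolding 5 by (intro blin[OF bounded_linear_vec_nth] dF that)
        \<comment> \<open>The equation \<open>F' = A F\<close> makes the derivative of an entry of
          \<open>F\<close> a polynomial in the generators.\<close>
        show "(\<lambda>t. (A t ** F t) $ i $ j) \<in> generated_algebra G"
          unfolding matrix_matrix_mult_def
          by (simp add: sum_4) (intro generated_algebra.add generated_algebra.mult A_in_G in_G)
      qed
    qed
  qed
  have "smooth_map_on I (\<lambda>t. F t $ i $ j)" for i j
    using G_closed in_G(5) by (rule smooth_map_on_generated_algebra)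
  then have smooth: "smooth_map_on I (\<lambda>t. (F t $ 2, F t $ 3, F t $ 4))"
    by - (rule smooth_map_on_componentwise, auto simp: Basis_prod_def Basis_vec_def inner_axis)
  \<comment> \<open>The derivative of \<gamma> is \<alpha> \<mu>, and \<mu> is orthogonal to
    \<open>v1\<close> and \<open>v2\<close>.\<close>
  have "ps_spacelike_framed_curve \<Delta> I (\<lambda>t. F t $ 2) (\<lambda>t. F t $ 3) (\<lambda>t. F t $ 4)"
    unfolding ps_spacelike_framed_curve_def using smooth
    by (auto simp: gram diag_mat_nth AdS3_def \<Delta> deriv sum_4 ip_add_left ip_scaleR_left A_def frenet_mat_def)
  \<comment> \<open>In the second component \<open>ip\<close> of \<open>v1'\<close> and
    \<open>v2\<close> is -\<epsilon> \<open>l\<close>, so the factor -\<epsilon> in the definition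
    restores \<open>l\<close> by \<epsilon>^2 = 1.\<close>
  moreover have "curvature I (\<lambda>t. F t $ 2) (\<lambda>t. F t $ 3) (\<lambda>t. F t $ 4) t = (\<alpha> t, l t, m t, n t)"
    if "t \<in> I" for t
    using that \<epsilon> unfolding curvature_def
    by (simp add: Let_def triple deriv sum_4 ip_add_left ip_scaleR_left gram diag_mat_nth A_def frenet_mat_def power2_eq_square)
  ultimately show ?thesis
    by blast
qed

end
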